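(* Let $X$ be a Hilbert space, $\varphi\in C^{2}(X,\mathbb{R})$, $h\in\mathbb{R}$ and $\varepsilon>0$. Assume that $$\|\varphi'(u)\|\geq 2\varepsilon\quad\text{for all } u\in\varphi^{-1}([h-2\varepsilon,h+2\varepsilon]).$$ Let $D$ be a subset of $X$ satisfying $D\subset\varphi^{-1}([h-\frac13\varepsilon,h+\frac13\varepsilon])$. Then there exists $\eta\in C(X,X)$ such that (i) $\eta(u)=u$ for all $u\notin\varphi^{-1}([h-2\varepsilon,h+2\varepsilon])\setminus D$; (ii) $\eta\big(\varphi^{-1}([h-\varepsilon,h-\frac12\varepsilon])\big)\subset\varphi^{-1}([h+\varepsilon,h+\frac32\varepsilon])$; (iii) $\eta\big(\varphi^{-1}([h+\frac12\varepsilon,h+\varepsilon])\big)\subset\varphi^{-1}([h-\frac32\varepsilon,h-\varepsilon])$.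
   Context: $X$ is a real Hilbert space with norm $\|\cdot\|$; $\varphi'(u)$ denotes the Fréchet derivative of $\varphi$ at $u$, with its dual norm (equivalently, the norm of the gradient $\nabla\varphi(u)$). $C(X,X)$ is the set of continuous maps from $X$ to $X$. *)

theory Defs
  imports "HOL-Analysis.Analysis"
begin

text \<open>
  Twice continuously Frechet differentiable on the whole space. The first derivative takes
  values in the bounded linear maps with the operator norm, and it is differentiable and its
  derivative continuous with respect to that norm.
\<close>

definition C2 :: "('a::real_normed_vector \<Rightarrow> 'b::real_normed_vector) \<Rightarrow> bool" where
  "C2 f \<longleftrightarrow>
    (\<exists>(f' :: 'a \<Rightarrow> 'a \<Rightarrow>\<^sub>L 'b) (f'' :: 'a \<Rightarrow> 'a \<Rightarrow>\<^sub>L ('a \<Rightarrow>\<^sub>L 'b)).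
      (\<forall>x. (f has_derivative blinfun_apply (f' x)) (at x)) \<and>
      (\<forall>x. (f' has_derivative blinfun_apply (f'' x)) (at x)) \<and>
      continuous_on UNIV f'')"

end

theory Submission
  imports Defs
begin

text \<open>
  The conclusion constrains \<open>\<eta>\<close> only through its continuity, its fixed points and the images of
  two bands, so \<open>\<eta>\<close> may collapse each band to a single point. Once there are a point \<open>b\<close> with
  \<open>\<phi> b = h + \<epsilon>\<close> and a point \<open>c\<close> with \<open>\<phi> c = h - \<epsilon>\<close>, the map
  \<open>\<eta> u = u + \<lambda> (\<phi> u) (b - u) + \<mu> (\<phi> u) (c - u)\<close>
  does what is required, where \<open>\<lambda>\<close> and \<open>\<mu>\<close> are bump functions on the line that equal 1 on
  \<open>[h - \<epsilon>, h - \<epsilon>/2]\<close> and \<open>[h + \<epsilon>/2, h + \<epsilon>]\<close>. Each vanishes on the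
  band of the other, on \<open>[h - \<epsilon>/3, h + \<epsilon>/3]\<close>, into which \<open>\<phi>\<close> maps \<open>D\<close>, and outside
  \<open>[h - 2\<epsilon>, h + 2\<epsilon>]\<close>.

  So the substance is the existence of \<open>b\<close> when the lower band is nonempty, and of \<open>c\<close> when the
  upper band is. If \<open>\<phi>\<close> takes a value in \<open>[h - \<epsilon>, h + \<epsilon>]\<close> but stays below \<open>h + \<epsilon>\<close>, then
  Ekeland's variational principle gives a point in this range from which \<open>\<phi>\<close> can
  increase with slope at most \<open>\<epsilon>\<close>, so that the derivative there has norm at most \<open>\<epsilon>\<close>,
  contradicting the lower bound \<open>2\<epsilon>\<close>. Thus \<open>\<phi>\<close> reaches the value \<open>h + \<epsilon>\<close>, exactly, by
  connectedness. The point \<open>c\<close> comes from the same argument for \<open>-\<phi>\<close>.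
\<close>

text \<open>
  Ekeland's principle, for maximisation. The relation ``from \<open>x\<close> one climbs to \<open>w\<close> with slope at
  least \<open>c\<close>'' is a preorder. Climbing at each step at least half of the height still available
  yields a sequence whose steps are controlled by the gain in \<open>f\<close>, hence a Cauchy sequence, and
  above its limit nothing is left to climb.
\<close>

lemma ekeland_variational_principle:
  fixes f :: "'a::complete_space \<Rightarrow> real"
  assumes cont: "continuous_on UNIV f" and bdd: "bdd_above (range f)" and c: "c > 0"
  obtains v where "f u + c * dist u v \<le> f v" "\<And>w. f w \<le> f v + c * dist v w"
proof -
  define F where "F x = {w. f x + c * dist x w \<le> f w}" for x
  have F_refl: "x \<in> F x" for x
    by (simp add: F_def)
  have F_trans: "z \<in> F x" if "y \<in> F x" "z \<in> F y" for x y z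
  proof -
    have "c * dist x z \<le> c * dist x y + c * dist y z"
      using mult_left_mono[OF dist_triangle[of x z y], of c] c by (simp add: distrib_left)
    then show ?thesis using that by (simp add: F_def)
  qed
  have F_closed: "closed (F x)" for x
    unfolding F_def using cont by (intro closed_Collect_le continuous_intros)
  have F_mono: "f x \<le> f w" if "w \<in> F x" for x w
  proof -
    have "0 \<le> c * dist x w"
      using c by simp
    then show ?thesis
      using that by (simp add: F_def)
  qed
  have bddF: "bdd_above (f ` F x)" for x
    by (rule bdd_above_mono[OF bdd]) auto
  have "\<exists>y\<in>F x. \<forall>w\<in>F x. f w \<le> 2 * f y - f x" for x
  proof (cases "\<exists>w\<in>F x. f x < f w")
    case True
    then obtain w0 where w0: "w0 \<in> F x" "f x < f w0"
      by blast
    have "f w0 \<le> (SUP w\<in>F x. f w)"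
      using w0 bddF by (intro cSUP_upper)
    then have "(f x + (SUP w\<in>F x. f w)) / 2 < (SUP w\<in>F x. f w)"
      using w0 by simp
    then obtain y where y: "y \<in> F x" "(f x + (SUP w\<in>F x. f w)) / 2 < f y"
      using less_cSUP_iff[OF _ bddF] F_refl by (metis empty_iff)
    have "f w \<le> 2 * f y - f x" if "w \<in> F x" for w
    proof -
      have "f w \<le> (SUP w\<in>F x. f w)"
        using that bddF by (intro cSUP_upper)
      then show ?thesis
        using y by (simp add: field_simps)
    qed
    then show ?thesis
      using y by blast
  next
    case False
    then show ?thesis
      using F_refl by (intro bexI[of _ x]) force+
  qed
  then obtain g where g: "\<And>x. g x \<in> F x" "\<And>x w. w \<in> F x \<Longrightarrow> f w \<le> 2 * f (g x) - f x"
    by metis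
  define x where "x n = (g ^^ n) u" for n
  have x_Suc: "x (Suc n) = g (x n)" for n
    by (simp add: x_def)
  have chain: "x n \<in> F (x m)" if "m \<le> n" for m n
    using that by (induction n rule: dec_induct) (auto simp: F_refl x_Suc intro: F_trans g(1))
  have "incseq (\<lambda>n. f (x n))"
    using F_mono chain by (auto simp: incseq_def)
  moreover obtain B where "\<And>y. f y \<le> B"
    using bdd by (auto simp: bdd_above_def)
  ultimately obtain L where L: "(\<lambda>n. f (x n)) \<longlonglongrightarrow> L"
    by (metis incseq_convergent)
  have "Cauchy x"
  proof (rule metric_CauchyI)
    fix e :: real
    assume "e > 0"
    then obtain M where M: "\<And>m n. m \<ge> M \<Longrightarrow> n \<ge> M \<Longrightarrow> dist (f (x m)) (f (x n)) < c * e"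
      using metric_CauchyD[OF LIMSEQ_imp_Cauchy[OF L], of "c * e"] c by auto
    have close: "dist (x m) (x n) < e" if "M \<le> m" "m \<le> n" for m n
    proof -
      have "c * dist (x m) (x n) < c * e"
        using M[of m n] chain[OF that(2)] that by (auto simp: F_def dist_real_def)
      then show ?thesis
        using c by simp
    qed
    show "\<exists>M. \<forall>m\<ge>M. \<forall>n\<ge>M. dist (x m) (x n) < e"
      by (metis close dist_commute linear)
  qed
  then obtain v where v: "x \<longlonglongrightarrow> v"
    by (metis Cauchy_convergent convergent_def)
  have v_in: "v \<in> F (x n)" for n
  proof (rule closed_sequentially[OF F_closed])
    show "(\<lambda>k. x (k + n)) \<longlonglongrightarrow> v"
      using v by (rule LIMSEQ_ignore_initial_segment)
  qed (auto intro: chain)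
  have "isCont f v"
    using cont by (simp add: continuous_on_eq_continuous_at)
  then have "L = f v"
    using isCont_tendsto_compose v L LIMSEQ_unique by blast
  then have lim: "(\<lambda>n. 2 * f (x (Suc n)) - f (x n)) \<longlonglongrightarrow> 2 * f v - f v"
    using L by (intro tendsto_intros LIMSEQ_Suc) auto
  have top: "f w \<le> f v" if "w \<in> F v" for w
  proof -
    have "f w \<le> 2 * f (x (Suc n)) - f (x n)" for n
      using g(2) F_trans[OF v_in that] by (simp add: x_Suc)
    then show ?thesis
      using LIMSEQ_le_const[OF lim] by simp
  qed
  have "f w \<le> f v + c * dist v w" for w
  proof (rule ccontr)
    assume *: "\<not> f w \<le> f v + c * dist v w"
    then have "f w \<le> f v"
      by (intro top) (simp add: F_def)
    then show False
      using * c by (smt (verit) mult_nonneg_nonneg zero_le_dist)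
  qed
  moreover have "f u + c * dist u v \<le> f v"
    using v_in[of 0] by (simp add: F_def x_def)
  ultimately show ?thesis
    by (rule that[rotated])
qed

text \<open>
  The one-sided difference quotients along \<open>x\<close> give \<open>f' x \<le> c * norm x\<close>. Using \<open>- x\<close> as well turns
  this one-sided bound into a bound of the absolute value.
\<close>

lemma onorm_derivative_le_if_slope_le:
  fixes f :: "'a::real_normed_vector \<Rightarrow> real"
  assumes der: "(f has_derivative f') (at v)" and c: "c \<ge> 0"
    and slope: "\<And>w. f w \<le> f v + c * dist v w"
  shows "onorm f' \<le> c"
proof (rule onorm_bound[OF c])
  interpret bounded_linear f'
    using der by (rule has_derivative_bounded_linear)
  have le: "f' x \<le> c * norm x" for x
  proof -
    have "((\<lambda>t. f (v + t *\<^sub>R x)) has_derivative (\<lambda>t. f' (t *\<^sub>R x))) (at 0)"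
      by (rule has_derivative_compose[of "\<lambda>t. v + t *\<^sub>R x", where g = f])
         (auto intro!: derivative_eq_intros simp: der)
    then have "((\<lambda>t. f (v + t *\<^sub>R x)) has_field_derivative f' x) (at 0)"
      by (simp add: has_field_derivative_def scaleR mult_commute_abs)
    then have "((\<lambda>t. (f (v + t *\<^sub>R x) - f v) / t) \<longlongrightarrow> f' x) (at 0)"
      by (simp add: DERIV_def)
    then have "((\<lambda>t. (f (v + t *\<^sub>R x) - f v) / t) \<longlongrightarrow> f' x) (at_right 0)"
      by (rule filterlim_mono) (auto simp: at_le)
    moreover have "\<forall>\<^sub>F t in at_right 0. (f (v + t *\<^sub>R x) - f v) / t \<le> c * norm x"
      using eventually_at_right_less[of "0::real"]
    proof eventually_elim
      case (elim t)
      have "f (v + t *\<^sub>R x) \<le> f v + c * (t * norm x)"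
        using slope[of "v + t *\<^sub>R x"] elim by (simp add: dist_norm)
      then show ?case
        using elim by (simp add: field_simps)
    qed
    ultimately show ?thesis
      by (rule tendsto_upperbound) simp
  qed
  show "norm (f' x) \<le> c * norm x" for x
    using le[of x] le[of "- x"] by (simp add: neg abs_le_iff)
qed

text \<open>
  A function that stays below \<open>b\<close> is bounded above, so a point provided by Ekeland's principle
  would have its value in \<open>[a, b]\<close> and a derivative of norm at most \<open>c\<close>.
\<close>

lemma level_attained_if_derivative_bounded_below:
  fixes f :: "'a::{real_normed_vector, complete_space} \<Rightarrow> real"
  assumes der: "\<And>x. (f has_derivative f' x) (at x)" and c: "c > 0"
    and large: "\<And>x. f x \<in> {a..b} \<Longrightarrow> onorm (f' x) > c"
    and u: "f u \<in> {a..b}"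
  obtains v where "f v = b"
proof -
  have cont: "continuous_on UNIV f"
    using der has_derivative_continuous continuous_at_imp_continuous_on by blast
  have "\<exists>w. b \<le> f w"
  proof (rule ccontr)
    assume below: "\<not> (\<exists>w. b \<le> f w)"
    then have "bdd_above (range f)"
      by (intro bdd_aboveI[of _ b]) (auto simp: not_le intro: less_imp_le)
    then obtain v where v: "f u + c * dist u v \<le> f v" "\<And>w. f w \<le> f v + c * dist v w"
      using ekeland_variational_principle[OF cont _ c] by blast
    have "0 \<le> c * dist u v"
      using c by simp
    then have "f v \<in> {a..b}"
      using u v(1) below by (auto simp: not_le intro: less_imp_le)
    moreover have "onorm (f' v) \<le> c"
      using onorm_derivative_le_if_slope_le[OF der _ v(2)] c by simp
    ultimately show False
      using large by fastforce
  qed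
  then obtain w where "b \<le> f w" ..
  moreover have "connected (range f)"
    using cont by (rule connected_continuous_image) (rule connected_UNIV)
  ultimately have "b \<in> range f"
    using u connected_contains_Icc[of "range f" "f u" "f w"] by auto
  then show ?thesis
    using that by auto
qed

definition bump :: "real \<Rightarrow> real" where
  "bump s = max 0 (min 1 (5/2 - 6 * \<bar>s\<bar>))"

lemma bump_eq_1: "\<bar>s\<bar> \<le> 1/4 \<Longrightarrow> bump s = 1"
  and bump_eq_0: "\<bar>s\<bar> \<ge> 5/12 \<Longrightarrow> bump s = 0"
  by (auto simp: bump_def)

lemma continuous_on_bump [continuous_intros]:
  "continuous_on S f \<Longrightarrow> continuous_on S (\<lambda>x. bump (f x))"
  unfolding bump_def by (intro continuous_intros)

theorem lemma2p1:
  fixes \<phi> :: "'a::{real_inner, complete_space} \<Rightarrow> real"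
    and h \<epsilon> :: real
    and D :: "'a set"
  assumes "C2 \<phi>"
    and "\<epsilon> > 0"
    and "\<forall>u \<in> \<phi> -` {h - 2 * \<epsilon> .. h + 2 * \<epsilon>}. onorm (frechet_derivative \<phi> (at u)) \<ge> 2 * \<epsilon>"
    and "D \<subseteq> \<phi> -` {h - 1/3 * \<epsilon> .. h + 1/3 * \<epsilon>}"
  shows "\<exists>\<eta> :: 'a \<Rightarrow> 'a. continuous_on UNIV \<eta> \<and>
    (\<forall>u. u \<notin> \<phi> -` {h - 2 * \<epsilon> .. h + 2 * \<epsilon>} - D \<longrightarrow> \<eta> u = u) \<and>
    \<eta> ` (\<phi> -` {h - \<epsilon> .. h - 1/2 * \<epsilon>}) \<subseteq> \<phi> -` {h + \<epsilon> .. h + 3/2 * \<epsilon>} \<and>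
    \<eta> ` (\<phi> -` {h + 1/2 * \<epsilon> .. h + \<epsilon>}) \<subseteq> \<phi> -` {h - 3/2 * \<epsilon> .. h - \<epsilon>}"
proof -
  note \<epsilon> = \<open>\<epsilon> > 0\<close>
  obtain \<phi>' :: "'a \<Rightarrow> 'a \<Rightarrow>\<^sub>L real" where der: "\<And>x. (\<phi> has_derivative \<phi>' x) (at x)"
    using assms(1) by (auto simp: C2_def)
  have cont: "continuous_on UNIV \<phi>"
    using der has_derivative_continuous continuous_at_imp_continuous_on by blast
  have large: "onorm (\<phi>' u) > \<epsilon>" if "\<phi> u \<in> {h - \<epsilon> .. h + \<epsilon>}" for u
  proof -
    have "onorm (frechet_derivative \<phi> (at u)) \<ge> 2 * \<epsilon>"
      using assms(3) that \<epsilon> by auto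
    then show ?thesis
      using frechet_derivative_at[OF der[of u]] \<epsilon> by simp
  qed

  have "\<exists>b. \<phi> b = h + \<epsilon>" if u: "\<phi> u \<in> {h - \<epsilon> .. h - 1/2 * \<epsilon>}" for u
  proof (rule level_attained_if_derivative_bounded_below[OF der \<epsilon>])
    show "onorm (\<phi>' x) > \<epsilon>" if "\<phi> x \<in> {h - \<epsilon> .. h + \<epsilon>}" for x
      using that by (rule large)
    show "\<phi> u \<in> {h - \<epsilon> .. h + \<epsilon>}"
      using u \<epsilon> by auto
  qed auto
  then obtain b where b: "\<And>u. \<phi> u \<in> {h - \<epsilon> .. h - 1/2 * \<epsilon>} \<Longrightarrow> \<phi> b = h + \<epsilon>"
    by metis
  have "\<exists>c. \<phi> c = h - \<epsilon>" if u: "\<phi> u \<in> {h + 1/2 * \<epsilon> .. h + \<epsilon>}" for u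
  proof -
    obtain c where "- \<phi> c = - (h - \<epsilon>)"
    proof (rule level_attained_if_derivative_bounded_below[where f = "\<lambda>x. - \<phi> x"])
      show "((\<lambda>x. - \<phi> x) has_derivative (\<lambda>y. - \<phi>' x y)) (at x)" for x
        using der by (rule has_derivative_minus)
      show "onorm (\<lambda>y. - \<phi>' x y) > \<epsilon>" if "- \<phi> x \<in> {- (h + \<epsilon>) .. - (h - \<epsilon>)}" for x
        using large[of x] that by (simp add: onorm_neg)
      show "- \<phi> u \<in> {- (h + \<epsilon>) .. - (h - \<epsilon>)}"
        using u \<epsilon> by auto
    qed (use \<epsilon> in auto)
    then have "\<phi> c = h - \<epsilon>"
      by simp
    then show ?thesis ..
  qed
  then obtain c where c: "\<And>u. \<phi> u \<in> {h + 1/2 * \<epsilon> .. h + \<epsilon>} \<Longrightarrow> \<phi> c = h - \<epsilon>"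
    by metis

  \<comment> \<open>The bands are centred at \<open>h - 3/4 \<epsilon>\<close> and \<open>h + 3/4 \<epsilon>\<close> with half-width \<open>\<epsilon>/4\<close>. As
    \<open>3/4 - 5/12 = 1/3\<close>, the bumps vanish on \<open>[h - \<epsilon>/3, h + \<epsilon>/3]\<close>, endpoints included.\<close>
  define s where "s u = (\<phi> u - h) / \<epsilon>" for u
  define \<eta> where
    "\<eta> u = u + bump (s u + 3/4) *\<^sub>R (b - u) + bump (s u - 3/4) *\<^sub>R (c - u)" for u
  have "continuous_on UNIV s"
    unfolding s_def using cont \<epsilon> by (intro continuous_intros) auto
  then have "continuous_on UNIV \<eta>"
    unfolding \<eta>_def by (intro continuous_intros)
  moreover have "\<eta> u = u" if u: "u \<notin> \<phi> -` {h - 2 * \<epsilon> .. h + 2 * \<epsilon>} - D" for u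
  proof -
    consider "\<phi> u < h - 2 * \<epsilon>" | "\<phi> u > h + 2 * \<epsilon>" | "\<phi> u \<in> {h - 1/3 * \<epsilon> .. h + 1/3 * \<epsilon>}"
      using u assms(4) by fastforce
    then have "s u < -2 \<or> s u > 2 \<or> -1/3 \<le> s u \<and> s u \<le> 1/3"
      using \<epsilon> by cases (auto simp: s_def field_simps)
    then have "bump (s u + 3/4) = 0" "bump (s u - 3/4) = 0"
      by (auto intro!: bump_eq_0)
    then show ?thesis
      by (simp add: \<eta>_def)
  qed
  moreover have "\<phi> (\<eta> u) \<in> {h + \<epsilon> .. h + 3/2 * \<epsilon>}"
    if u: "\<phi> u \<in> {h - \<epsilon> .. h - 1/2 * \<epsilon>}" for u
  proof -
    have "-1 \<le> s u" "s u \<le> -1/2"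
      using u \<epsilon> by (auto simp: s_def field_simps)
    then have "bump (s u + 3/4) = 1" "bump (s u - 3/4) = 0"
      by (auto intro!: bump_eq_0 bump_eq_1 simp: abs_if)
    then have "\<eta> u = b"
      by (simp add: \<eta>_def)
    then show ?thesis
      using b[OF u] \<epsilon> by simp
  qed
  moreover have "\<phi> (\<eta> u) \<in> {h - 3/2 * \<epsilon> .. h - \<epsilon>}"
    if u: "\<phi> u \<in> {h + 1/2 * \<epsilon> .. h + \<epsilon>}" for u
  proof -
    have "1/2 \<le> s u" "s u \<le> 1"
      using u \<epsilon> by (auto simp: s_def field_simps)
    then have "bump (s u + 3/4) = 0" "bump (s u - 3/4) = 1"
      by (auto intro!: bump_eq_0 bump_eq_1 simp: abs_if)
    then have "\<eta> u = c"
      by (simp add: \<eta>_def)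
    then show ?thesis
      using c[OF u] \<epsilon> by simp
  qed
  ultimately show ?thesis
    by (intro exI[of _ \<eta>]) (auto simp: image_subset_iff)
qed

end
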